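(* Let $A$ and $B$ be arbitrary, possibly infinite, non-empty sets. For any class $\mathcal{F}$ of functions of several variables from $A$ to $B$, the following two conditions are equivalent: (i) $\mathcal{F}$ is locally closed and it is closed under permutation of variables and addition of dummy variables. (ii) $\mathcal{F}$ can be characterized by a set $\mathcal{T}$ of generalized constraints from $A$ to $B$.
   Context: $\mathbb{N}$ is the set of nonnegative integers; $m\in\mathbb{N}$ is identified with $\{0,\dots,m-1\}$, and an $m$-tuple over $A$ is a map $m\to A$. A function of several variables from $A$ to $B$ is a map $f\colon A^n\to B$ for some integer $n\ge 1$ (its arity). A class is a subset $\mathcal{C}\subseteq\bigcup_{n\ge1}B^{A^n}$; $\mathcal{C}^{(n)}$ is the set of its $n$-ary members. For $n$-ary $f$: $(\zeta f)(x_1,\dots,x_n)=f(x_2,\dots,x_n,x_1)$ and $(\tau f)(x_1,\dots,x_n)=f(x_2,x_1,x_3,\dots,x_n)$ if $n>1$, $\zeta f=\tau f=f$ if $n=1$; $(\nabla f)(x_1,\dots,x_{n+1})=f(x_2,\dots,x_{n+1})$. Closed under permutation of variables means closed under $\zeta$ and $\tau$; closed under addition of dummy variables means closed under $\nabla$. A class $\mathcal{C}$ is locally closed if for every $n\geq 1$ and every $g\colon A^n\to B$, we have $g\in\mathcal{C}$ whenever for every finite $F\subseteq A^n$ there is $f\in\mathcal{C}^{(n)}$ with $g|_F=f|_F$. An $m\times n$ matrix $\mathbf{M}\in A^{m\times n}$ is an $n$-tuple $(\mathbf{a}^1,\dots,\mathbf{a}^n)$ of $m$-tuples over $A$ (its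 columns). For $f\colon A^n\to B$, $f\mathbf{M}\in B^m$ is the $m$-tuple $i\mapsto f(\mathbf{a}^1(i),\dots,\mathbf{a}^n(i))$. For $m\ge1$, an $m$-ary repetition function on $A$ is a map $\phi\colon A^m\to\mathbb{N}\cup\{\infty\}$. An $m$-ary generalized constraint from $A$ to $B$ is a pair $(\phi,S)$ with $\phi$ an $m$-ary repetition function on $A$ and $S\subseteq B^m$. For an $m\times n$ matrix $\mathbf{M}$ over $A$, $\mathbf{M}\prec\phi$ means that each $\mathbf{a}\in A^m$ occurs as a column of $\mathbf{M}$ at most $\phi(\mathbf{a})$ times. A function $f\colon A^n\to B$ satisfies $(\phi,S)$ if $f\mathbf{M}\in S$ for every $m\times n$ matrix $\mathbf{M}$ with $\mathbf{M}\prec\phi$. A class $\mathcal{F}$ is characterized by a set $\mathcal{T}$ of generalized constraints if $\mathcal{F}$ is precisely the set of functions of several variables from $A$ to $B$ satisfying all members of $\mathcal{T}$. *)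

theory Defs
  imports Complex_Main "HOL-Library.FuncSet" "HOL-Library.Extended_Nat"
begin

text \<open>
  The number \<open>n\<close> is identified with \<open>{..<n}\<close> and maps are extensional functions, so variables,
  rows and columns are indexed from 0.
\<close>

definition tuples :: "'a set \<Rightarrow> nat \<Rightarrow> (nat \<Rightarrow> 'a) set" where
  "tuples A n = ({..<n} \<rightarrow>\<^sub>E A)"

text \<open>
  The arity is stored with the function because it is not always recoverable from the underlying
  HOL function: for instance, if \<open>A = {undefined}\<close>, then \<open>tuples A n\<close> is the same HOL set for
  all \<open>n\<close>, whereas the domains \<open>A\<^sup>n\<close> are pairwise distinct.
\<close>

type_synonym ('a, 'b) mfun = "nat \<times> ((nat \<Rightarrow> 'a) \<Rightarrow> 'b)"

definition multivar_functions :: "'a set \<Rightarrow> 'b set \<Rightarrow> ('a, 'b) mfun set" where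
  "multivar_functions A B = {(n, f). n \<ge> 1 \<and> f \<in> tuples A n \<rightarrow>\<^sub>E B}"

fun zeta :: "'a set \<Rightarrow> ('a, 'b) mfun \<Rightarrow> ('a, 'b) mfun" where
  "zeta A (n, f) =
     (if n > 1
      then (n, \<lambda>x\<in>tuples A n. f (\<lambda>i\<in>{..<n}. if i = n - 1 then x 0 else x (i + 1)))
      else (n, f))"

fun tau :: "'a set \<Rightarrow> ('a, 'b) mfun \<Rightarrow> ('a, 'b) mfun" where
  "tau A (n, f) =
     (if n > 1 then (n, \<lambda>x\<in>tuples A n. f (x(0 := x 1, 1 := x 0))) else (n, f))"

fun nabla :: "'a set \<Rightarrow> ('a, 'b) mfun \<Rightarrow> ('a, 'b) mfun" where
  "nabla A (n, f) = (n + 1, \<lambda>x\<in>tuples A (n + 1). f (\<lambda>i\<in>{..<n}. x (i + 1)))"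

definition closed_under_permutation :: "'a set \<Rightarrow> ('a, 'b) mfun set \<Rightarrow> bool" where
  "closed_under_permutation A C \<longleftrightarrow> (\<forall>f\<in>C. zeta A f \<in> C \<and> tau A f \<in> C)"

definition closed_under_dummies :: "'a set \<Rightarrow> ('a, 'b) mfun set \<Rightarrow> bool" where
  "closed_under_dummies A C \<longleftrightarrow> (\<forall>f\<in>C. nabla A f \<in> C)"

definition locally_closed :: "'a set \<Rightarrow> 'b set \<Rightarrow> ('a, 'b) mfun set \<Rightarrow> bool" where
  "locally_closed A B C \<longleftrightarrow>
     (\<forall>n\<ge>1. \<forall>g \<in> tuples A n \<rightarrow>\<^sub>E B.
        (\<forall>F. finite F \<and> F \<subseteq> tuples A n \<longrightarrow> (\<exists>f. (n, f) \<in> C \<and> restrict g F = restrict f F))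
        \<longrightarrow> (n, g) \<in> C)"

text \<open>A matrix is the tuple of its columns: the entry in row \<open>i\<close> and column \<open>j\<close> is \<open>M j i\<close>.\<close>

definition matrices :: "'a set \<Rightarrow> nat \<Rightarrow> nat \<Rightarrow> (nat \<Rightarrow> nat \<Rightarrow> 'a) set" where
  "matrices A m n = tuples (tuples A m) n"

definition apply_matrix ::
    "nat \<Rightarrow> nat \<Rightarrow> ((nat \<Rightarrow> 'a) \<Rightarrow> 'b) \<Rightarrow> (nat \<Rightarrow> nat \<Rightarrow> 'a) \<Rightarrow> nat \<Rightarrow> 'b" where
  "apply_matrix m n f M = (\<lambda>i\<in>{..<m}. f (\<lambda>j\<in>{..<n}. M j i))"

text \<open>A constraint \<open>(\<phi>, S)\<close> is stored together with its arity, for the same reason as above.\<close>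

type_synonym ('a, 'b) gconstraint = "nat \<times> ((nat \<Rightarrow> 'a) \<Rightarrow> enat) \<times> (nat \<Rightarrow> 'b) set"

definition repetition_functions :: "'a set \<Rightarrow> nat \<Rightarrow> ((nat \<Rightarrow> 'a) \<Rightarrow> enat) set" where
  "repetition_functions A m = (tuples A m \<rightarrow>\<^sub>E UNIV)"

definition generalized_constraints :: "'a set \<Rightarrow> 'b set \<Rightarrow> ('a, 'b) gconstraint set" where
  "generalized_constraints A B =
     {(m, \<phi>, S). m \<ge> 1 \<and> \<phi> \<in> repetition_functions A m \<and> S \<subseteq> tuples B m}"

definition matrix_prec ::
    "'a set \<Rightarrow> nat \<Rightarrow> nat \<Rightarrow> (nat \<Rightarrow> nat \<Rightarrow> 'a) \<Rightarrow> ((nat \<Rightarrow> 'a) \<Rightarrow> enat) \<Rightarrow> bool" where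
  "matrix_prec A m n M \<phi> \<longleftrightarrow> (\<forall>a\<in>tuples A m. enat (card {j \<in> {..<n}. M j = a}) \<le> \<phi> a)"

fun satisfies :: "'a set \<Rightarrow> ('a, 'b) mfun \<Rightarrow> ('a, 'b) gconstraint \<Rightarrow> bool" where
  "satisfies A (n, f) (m, \<phi>, S) \<longleftrightarrow>
     (\<forall>M\<in>matrices A m n. matrix_prec A m n M \<phi> \<longrightarrow> apply_matrix m n f M \<in> S)"

definition characterized_by ::
    "'a set \<Rightarrow> 'b set \<Rightarrow> ('a, 'b) mfun set \<Rightarrow> ('a, 'b) gconstraint set \<Rightarrow> bool" where
  "characterized_by A B \<F> T \<longleftrightarrow> \<F> = {f \<in> multivar_functions A B. \<forall>c\<in>T. satisfies A f c}"

end

theory Submission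
  imports Defs "HOL-Combinatorics.Permutations"
begin

text \<open>
  The operations \<open>\<zeta>\<close>, \<open>\<tau>\<close> and \<open>\<nabla>\<close> substitute variables along an injection, and together they
  generate all such substitutions. Substitution along an injection acts on matrices by selecting
  distinct columns, which preserves \<open>\<prec> \<phi>\<close>; this gives the closure conditions from a
  characterization. Conversely, if \<open>g\<close> is not in the class, local closure yields finitely many
  points on which no member of the class agrees with \<open>g\<close>. Let \<open>M\<close> be the matrix with these points
  as rows, let \<open>\<phi>\<close> count the occurrences of the columns of \<open>M\<close>, and let \<open>S\<close> consist of all
  \<open>f N\<close> with \<open>f\<close> in the class and \<open>N \<prec> \<phi>\<close>. Every such \<open>N\<close> selects distinct columns of \<open>M\<close>, so
  \<open>f N = f' M\<close> for some \<open>f'\<close> in the class of the same arity as \<open>g\<close>, and hence \<open>g M \<notin> S\<close>.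
\<close>

section \<open>Substitution of variables\<close>

text \<open>\<open>\<sigma>\<close> sends each variable of \<open>f\<close> to a variable of the new
  function; the variables outside its image on \<open>{..<k}\<close> are dummy. A map that is not
  injective there would identify variables.\<close>

definition reindex ::
    "'a set \<Rightarrow> nat \<Rightarrow> nat \<Rightarrow> (nat \<Rightarrow> nat) \<Rightarrow> ((nat \<Rightarrow> 'a) \<Rightarrow> 'b) \<Rightarrow> (nat \<Rightarrow> 'a) \<Rightarrow> 'b" where
  "reindex A k n \<sigma> f = (\<lambda>x\<in>tuples A n. f (\<lambda>i\<in>{..<k}. x (\<sigma> i)))"

lemma select_in_tuples:
  assumes "x \<in> tuples A n" and "\<sigma> ` {..<k} \<subseteq> {..<n}"
  shows "(\<lambda>i\<in>{..<k}. x (\<sigma> i)) \<in> tuples A k"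
  using assms by (auto simp: tuples_def)

lemma reindex_cong:
  assumes "\<And>i. i < k \<Longrightarrow> \<sigma> i = \<rho> i"
  shows "reindex A k n \<sigma> f = reindex A k n \<rho> f"
proof -
  have "(\<lambda>i\<in>{..<k}. x (\<sigma> i)) = (\<lambda>i\<in>{..<k}. x (\<rho> i))" for x :: "nat \<Rightarrow> 'a"
    using assms by (intro restrict_ext) simp
  then show ?thesis
    by (simp add: reindex_def)
qed

text \<open>Variable \<open>i\<close> of \<open>f\<close> reads place \<open>\<rho> i\<close> of a
  tuple whose entries are read from \<open>x\<close> through \<open>\<sigma>\<close>, so the outer
  substitution becomes the outer factor. The condition on \<open>\<rho>\<close> keeps
  \<open>\<rho> i\<close> below \<open>l\<close>, where the restricted tuple takes its entries from
  \<open>x\<close>.\<close>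

lemma reindex_reindex:
  assumes "\<sigma> ` {..<l} \<subseteq> {..<n}" and "\<rho> ` {..<k} \<subseteq> {..<l}"
  shows "reindex A l n \<sigma> (reindex A k l \<rho> f) = reindex A k n (\<sigma> \<circ> \<rho>) f"
proof -
  have "reindex A k l \<rho> f (\<lambda>i\<in>{..<l}. x (\<sigma> i)) = f (\<lambda>i\<in>{..<k}. x (\<sigma> (\<rho> i)))"
    if "x \<in> tuples A n" for x
  proof -
    have "(\<lambda>i\<in>{..<k}. (\<lambda>i\<in>{..<l}. x (\<sigma> i)) (\<rho> i)) = (\<lambda>i\<in>{..<k}. x (\<sigma> (\<rho> i)))"
      using assms(2) by (auto simp: restrict_def fun_eq_iff)
    then show ?thesis
      using select_in_tuples[OF that assms(1)] by (simp add: reindex_def)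
  qed
  then show ?thesis
    unfolding reindex_def[of A l n] reindex_def[of A k n] by (intro restrict_ext) simp
qed

lemma reindex_ident:
  assumes "f \<in> tuples A n \<rightarrow>\<^sub>E B" and "\<And>i. i < n \<Longrightarrow> \<sigma> i = i"
  shows "reindex A n n \<sigma> f = f"
proof -
  have "(\<lambda>i\<in>{..<n}. x (\<sigma> i)) = x" if "x \<in> tuples A n" for x
  proof -
    have "(\<lambda>i\<in>{..<n}. x (\<sigma> i)) = restrict x {..<n}"
      using assms(2) by (intro restrict_ext) simp
    also have "\<dots> = x"
      using that unfolding tuples_def by (rule PiE_restrict)
    finally show ?thesis .
  qed
  then have "reindex A n n \<sigma> f = restrict f (tuples A n)"
    unfolding reindex_def by (intro restrict_ext) simp
  also have "\<dots> = f"
    using assms(1) by (rule PiE_restrict)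
  finally show ?thesis .
qed

lemma reindex_funcset:
  assumes "f \<in> tuples A k \<rightarrow>\<^sub>E B" and "\<sigma> ` {..<k} \<subseteq> {..<n}"
  shows "reindex A k n \<sigma> f \<in> tuples A n \<rightarrow>\<^sub>E B"
proof -
  have "f (\<lambda>i\<in>{..<k}. x (\<sigma> i)) \<in> B" if "x \<in> tuples A n" for x
    using assms(1) select_in_tuples[OF that assms(2)] by (rule PiE_mem)
  then show ?thesis
    by (simp add: reindex_def)
qed

section \<open>The three operations as substitutions\<close>

definition rotation :: "nat \<Rightarrow> nat \<Rightarrow> nat" where
  "rotation n i = (if i = n - 1 then 0 else i + 1)"

lemma rotation_eq_mod: "i < n \<Longrightarrow> rotation n i = (i + 1) mod n"
  by (auto simp: rotation_def)

lemma zeta_eq_reindex: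
  assumes "n > 1"
  shows "zeta A (n, f) = (n, reindex A n n (rotation n) f)"
proof -
  have "(\<lambda>i\<in>{..<n}. if i = n - 1 then x 0 else x (i + 1)) = (\<lambda>i\<in>{..<n}. x (rotation n i))"
    for x :: "nat \<Rightarrow> 'a"
    by (intro restrict_ext) (simp add: rotation_def)
  then show ?thesis
    using assms by (simp only: zeta.simps reindex_def if_True)
qed

lemma tau_eq_reindex:
  assumes "n > 1"
  shows "tau A (n, f) = (n, reindex A n n (transpose 0 1) f)"
proof -
  have "x(0 := x 1, 1 := x 0) = (\<lambda>i\<in>{..<n}. x (transpose 0 1 i))" if "x \<in> tuples A n" for x
  proof
    fix i
    \<comment> \<open>From index \<open>n\<close> on the restricted tuple is
      \<open>undefined\<close>. The update touches only places 0 and 1, both below \<open>n\<close>,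
      so extensionality of \<open>x\<close> gives agreement there.\<close>
    have "x i = undefined" if "\<not> i < n"
      using \<open>x \<in> tuples A n\<close> that by (auto simp: tuples_def intro: PiE_arb)
    then show "(x(0 := x 1, 1 := x 0)) i = (\<lambda>i\<in>{..<n}. x (transpose 0 1 i)) i"
      using assms by (auto simp: transpose_def)
  qed
  then have "(\<lambda>x\<in>tuples A n. f (x(0 := x 1, 1 := x 0))) = reindex A n n (transpose 0 1) f"
    unfolding reindex_def by (intro restrict_ext) metis
  then show ?thesis
    using assms by (simp only: tau.simps if_True)
qed

lemma nabla_eq_reindex: "nabla A (n, f) = (n + 1, reindex A n (n + 1) Suc f)"
  by (simp add: reindex_def)

section \<open>Closure under injective substitutions\<close>

text \<open>For fixed \<open>n\<close> these maps are closed under composition, so generators of the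
  symmetric group suffice. The range condition is included because \<open>reindex_reindex\<close>
  requires it.\<close>

definition preserves :: "'a set \<Rightarrow> ('a, 'b) mfun set \<Rightarrow> nat \<Rightarrow> (nat \<Rightarrow> nat) \<Rightarrow> bool" where
  "preserves A C n \<sigma> \<longleftrightarrow>
     \<sigma> ` {..<n} \<subseteq> {..<n} \<and> (\<forall>f. (n, f) \<in> C \<longrightarrow> (n, reindex A n n \<sigma> f) \<in> C)"

lemma preserves_comp:
  assumes "preserves A C n \<sigma>" and "preserves A C n \<rho>"
  shows "preserves A C n (\<sigma> \<circ> \<rho>)"
  unfolding preserves_def
proof (intro conjI allI impI)
  have \<sigma>: "\<sigma> ` {..<n} \<subseteq> {..<n}" and \<rho>: "\<rho> ` {..<n} \<subseteq> {..<n}"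
    using assms by (simp_all add: preserves_def)
  then show "(\<sigma> \<circ> \<rho>) ` {..<n} \<subseteq> {..<n}"
    by fastforce
  show "(n, reindex A n n (\<sigma> \<circ> \<rho>) f) \<in> C" if "(n, f) \<in> C" for f
    using that assms unfolding reindex_reindex[OF \<sigma> \<rho>, symmetric] preserves_def by blast
qed

lemma preserves_cong:
  assumes "preserves A C n \<sigma>" and "\<And>i. i < n \<Longrightarrow> \<rho> i = \<sigma> i"
  shows "preserves A C n \<rho>"
proof -
  have "reindex A n n \<rho> f = reindex A n n \<sigma> f" for f :: "(nat \<Rightarrow> 'a) \<Rightarrow> 'b"
    using assms(2) by (rule reindex_cong)
  then show ?thesis
    using assms by (auto simp: preserves_def image_subset_iff)
qed

lemma preserves_ident:
  assumes "C \<subseteq> multivar_functions A B" and "\<And>i. i < n \<Longrightarrow> \<sigma> i = i"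
  shows "preserves A C n \<sigma>"
proof -
  have "reindex A n n \<sigma> f = f" if "(n, f) \<in> C" for f
    using that assms by (intro reindex_ident[where B = B]) (auto simp: multivar_functions_def)
  then show ?thesis
    using assms(2) by (auto simp: preserves_def)
qed

section \<open>The symmetric group from the rotation and one transposition\<close>

lemma preserves_rotation:
  assumes "closed_under_permutation A C" and "n > 1"
  shows "preserves A C n (\<lambda>i. (i + 1) mod n)"
proof -
  have "preserves A C n (rotation n)"
    unfolding preserves_def
  proof (intro conjI allI impI)
    show "rotation n ` {..<n} \<subseteq> {..<n}"
      using assms(2) by (auto simp: rotation_def)
    show "(n, reindex A n n (rotation n) f) \<in> C" if "(n, f) \<in> C" for f
      using that assms(1) unfolding closed_under_permutation_def zeta_eq_reindex[OF assms(2), symmetric]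
      by blast
  qed
  then show ?thesis
    by (rule preserves_cong) (simp add: rotation_eq_mod)
qed

text \<open>These are the powers of the rotation. They include inverses: on \<open>{..<n}\<close>
  the shift by \<open>n - a\<close> undoes the shift by \<open>a\<close> when
  \<open>a \<le> n\<close>.\<close>

lemma preserves_shift:
  assumes "C \<subseteq> multivar_functions A B" and "closed_under_permutation A C" and "n > 1"
  shows "preserves A C n (\<lambda>i. (i + d) mod n)"
proof (induction d)
  case 0
  show ?case
    by (rule preserves_ident[OF assms(1)]) simp
next
  case (Suc d)
  show ?case
    using preserves_comp[OF preserves_rotation[OF assms(2,3)] Suc]
    by (rule preserves_cong) (simp add: mod_Suc_eq)
qed

lemma preserves_transpose_0_1:
  assumes "closed_under_permutation A C" and "n > 1"
  shows "preserves A C n (transpose 0 1)"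
  unfolding preserves_def
proof (intro conjI allI impI)
  show "transpose 0 1 ` {..<n} \<subseteq> {..<n}"
    using assms(2) by (auto simp: transpose_def)
  show "(n, reindex A n n (transpose 0 1) f) \<in> C" if "(n, f) \<in> C" for f
    using that assms(1) unfolding closed_under_permutation_def tau_eq_reindex[OF assms(2), symmetric]
    by blast
qed

text \<open>Conjugation: rotate so that \<open>a\<close> and \<open>Suc a\<close> land on 0 and 1,
  swap these, rotate back. Adding \<open>n - a\<close> stands for subtracting \<open>a\<close>
  modulo \<open>n\<close>.\<close>

lemma shift_conjugate_transpose:
  assumes "a + 1 < n" and "i < n"
  shows "(transpose 0 1 ((i + (n - a)) mod n) + a) mod n = transpose a (Suc a) i"
proof (cases "i < a")
  case True
  \<comment> \<open>There is no wrap-around here, and \<open>i + (n - a)\<close> is at least 2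
    because \<open>a + 1 < n\<close>, so the swap of 0 and 1 fixes it.\<close>
  then have "(i + (n - a)) mod n = i + (n - a)"
    using assms by simp
  moreover have "transpose 0 1 (i + (n - a)) = i + (n - a)"
    using assms(1) by (intro transpose_apply_other) auto
  ultimately show ?thesis
    using True assms by (simp add: transpose_def)
next
  case False
  then have "i + (n - a) = i - a + n"
    using assms by linarith
  then have "(i + (n - a)) mod n = (i - a + n) mod n"
    by (rule arg_cong)
  also have "\<dots> = i - a"
    using assms(2) by simp
  finally have "(i + (n - a)) mod n = i - a" .
  moreover obtain e where "i = a + e"
    using False by (metis not_less le_iff_add)
  ultimately show ?thesis
    using assms by (auto simp: transpose_def)
qed

lemma preserves_adjacent_transpose:
  assumes "C \<subseteq> multivar_functions A B" and "closed_under_permutation A C" and "a + 1 < n"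
  shows "preserves A C n (transpose a (Suc a))"
proof -
  have n: "n > 1"
    using assms(3) by simp
  note shift = preserves_shift[OF assms(1,2) n]
  have "preserves A C n ((\<lambda>i. (i + a) mod n) \<circ> (transpose 0 1 \<circ> (\<lambda>i. (i + (n - a)) mod n)))"
    by (intro preserves_comp shift preserves_transpose_0_1 assms n)
  then show ?thesis
    by (rule preserves_cong) (use shift_conjugate_transpose[OF assms(3)] in simp)
qed

text \<open>Induction on the distance: conjugating by the adjacent transposition at the upper end
  moves that end one place up.\<close>

lemma preserves_transpose_less:
  assumes "C \<subseteq> multivar_functions A B" and "closed_under_permutation A C"
    and "a + Suc d < n"
  shows "preserves A C n (transpose a (a + Suc d))"
  using assms(3)
proof (induction d)
  case 0
  then show ?case
    using preserves_adjacent_transpose[OF assms(1,2)] by simp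
next
  case (Suc d)
  let ?t = "transpose (a + Suc d) (Suc (a + Suc d))"
  have t: "preserves A C n ?t"
    using preserves_adjacent_transpose[OF assms(1,2)] Suc.prems by simp
  have "preserves A C n (?t \<circ> (transpose a (a + Suc d) \<circ> ?t))"
    by (intro preserves_comp t Suc.IH) (use Suc.prems in simp)
  then show ?case
    by (rule preserves_cong) (auto simp: transpose_def)
qed

lemma preserves_transpose:
  assumes "C \<subseteq> multivar_functions A B" and "closed_under_permutation A C"
    and "a < n" and "b < n"
  shows "preserves A C n (transpose a b)"
proof (cases a b rule: linorder_cases)
  case less
  then obtain d where "b = a + Suc d"
    using less_natE by auto
  then show ?thesis
    using preserves_transpose_less[OF assms(1,2)] assms(4) by blast
next
  case equal
  then show ?thesis
    using preserves_ident[OF assms(1)] by simp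
next
  case greater
  then obtain d where "a = b + Suc d"
    using less_natE by auto
  then show ?thesis
    using preserves_transpose_less[OF assms(1,2)] assms(3) by (metis transpose_commute)
qed

text \<open>Every permutation of a finite set is a product of transpositions.\<close>

lemma preserves_permutation:
  assumes "C \<subseteq> multivar_functions A B" and "closed_under_permutation A C"
    and "\<pi> permutes {..<n}"
  shows "preserves A C n \<pi>"
  using finite_lessThan assms(3)
proof (induction rule: permutes_rev_induct)
  case id
  show ?case
    by (rule preserves_ident[OF assms(1)]) simp
next
  case (swap a b p)
  then show ?case
    using preserves_comp preserves_transpose[OF assms(1,2)] by blast
qed

section \<open>Dummy variables and arbitrary injections\<close>

lemma closed_under_dummies_shift:
  assumes "C \<subseteq> multivar_functions A B" and "closed_under_dummies A C" and "(k, f) \<in> C"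
  shows "(d + k, reindex A k (d + k) (\<lambda>i. i + d) f) \<in> C"
proof (induction d)
  case 0
  have "reindex A k k (\<lambda>i. i) f = f"
    using assms(1,3) by (intro reindex_ident[where B = B]) (auto simp: multivar_functions_def)
  then show ?case
    using assms(3) by simp
next
  case (Suc d)
  \<comment> \<open>\<open>nabla\<close> puts the new variable in front, so each application moves
    the variables of \<open>f\<close> one place up.\<close>
  have "reindex A (d + k) (d + k + 1) Suc (reindex A k (d + k) (\<lambda>i. i + d) f) =
      reindex A k (d + k + 1) (Suc \<circ> (\<lambda>i. i + d)) f"
    by (rule reindex_reindex) auto
  moreover have "nabla A (d + k, reindex A k (d + k) (\<lambda>i. i + d) f) \<in> C"
    using Suc assms(2) unfolding closed_under_dummies_def by blast
  ultimately show ?case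
    unfolding nabla_eq_reindex by (simp add: comp_def)
qed

text \<open>The injection misses exactly \<open>d\<close> points, as many as there are leading
  places, so any bijection between the two completes it.\<close>

lemma injection_extends_to_permutation:
  fixes \<sigma> :: "nat \<Rightarrow> nat"
  assumes "inj_on \<sigma> {..<k}" and "\<sigma> ` {..<k} \<subseteq> {..<d + k}"
  obtains \<pi> where "\<pi> permutes {..<d + k}" and "\<And>i. i < k \<Longrightarrow> \<pi> (i + d) = \<sigma> i"
proof -
  have "card ({..<d + k} - \<sigma> ` {..<k}) = card {..<d}"
    using assms by (simp add: card_Diff_subset card_image)
  then obtain h where h: "bij_betw h {..<d} ({..<d + k} - \<sigma> ` {..<k})"
    by (metis finite_Diff finite_lessThan finite_same_card_bij)
  \<comment> \<open>The leading \<open>d\<close> places go through \<open>h\<close> to the points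
    that \<open>\<sigma>\<close> misses; the next \<open>k\<close> follow \<open>\<sigma>\<close>
    once the offset \<open>d\<close> is removed. The identity from \<open>d + k\<close> on is what
    \<open>permutes\<close> demands.\<close>
  define \<pi> where "\<pi> i = (if i < d then h i else if i < d + k then \<sigma> (i - d) else i)" for i
  have "bij_betw (\<lambda>i. i - d) {d..<d + k} {..<k}"
    by (rule bij_betw_byWitness[where f' = "\<lambda>i. i + d"]) auto
  then have "bij_betw (\<sigma> \<circ> (\<lambda>i. i - d)) {d..<d + k} (\<sigma> ` {..<k})"
    using assms(1) bij_betw_trans inj_on_imp_bij_betw by blast
  then have "bij_betw \<pi> {d..<d + k} (\<sigma> ` {..<k})"
    by (rule bij_betw_cong[THEN iffD1, rotated]) (simp add: \<pi>_def)
  moreover have "bij_betw \<pi> {..<d} ({..<d + k} - \<sigma> ` {..<k})"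
    using h by (rule bij_betw_cong[THEN iffD1, rotated]) (simp add: \<pi>_def)
  ultimately have "bij_betw \<pi> ({..<d} \<union> {d..<d + k})
      (({..<d + k} - \<sigma> ` {..<k}) \<union> \<sigma> ` {..<k})"
    by (intro bij_betw_combine) auto
  moreover have "{..<d} \<union> {d..<d + k} = {..<d + k}"
    by auto
  moreover have "({..<d + k} - \<sigma> ` {..<k}) \<union> \<sigma> ` {..<k} = {..<d + k}"
    using assms(2) by blast
  ultimately have "\<pi> permutes {..<d + k}"
    by (intro bij_imp_permutes) (auto simp: \<pi>_def)
  then show thesis
    by (rule that) (simp add: \<pi>_def)
qed

text \<open>Factor \<open>\<sigma>\<close> as a permutation after the shift by \<open>d\<close>:
  prepend \<open>d\<close> dummy variables, then permute all \<open>n\<close> variables.\<close>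

lemma closed_under_injective_reindex:
  assumes "C \<subseteq> multivar_functions A B"
    and "closed_under_permutation A C" and "closed_under_dummies A C"
    and "(k, f) \<in> C" and "inj_on \<sigma> {..<k}" and "\<sigma> ` {..<k} \<subseteq> {..<n}"
  shows "(n, reindex A k n \<sigma> f) \<in> C"
proof -
  have "k \<le> n"
    using card_inj_on_le[OF assms(5,6)] by simp
  then obtain d where n: "n = d + k"
    using le_iff_add by (metis add.commute)
  obtain \<pi> where \<pi>: "\<pi> permutes {..<n}" and \<sigma>: "\<And>i. i < k \<Longrightarrow> \<pi> (i + d) = \<sigma> i"
    using injection_extends_to_permutation[OF assms(5)] assms(6) unfolding n by metis
  have pres: "preserves A C n \<pi>"
    by (rule preserves_permutation[OF assms(1,2) \<pi>])
  have "(n, reindex A n n \<pi> (reindex A k n (\<lambda>i. i + d) f)) \<in> C"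
    using pres closed_under_dummies_shift[OF assms(1,3,4)] unfolding preserves_def n by blast
  moreover have "reindex A n n \<pi> (reindex A k n (\<lambda>i. i + d) f) =
      reindex A k n (\<pi> \<circ> (\<lambda>i. i + d)) f"
    using pres by (intro reindex_reindex) (auto simp: preserves_def n)
  moreover have "\<dots> = reindex A k n \<sigma> f"
    by (rule reindex_cong) (simp add: \<sigma>)
  ultimately show ?thesis
    by simp
qed

section \<open>Generalized constraints\<close>

lemma matrix_row_in_tuples:
  assumes "M \<in> matrices A m n" and "i < m"
  shows "(\<lambda>j\<in>{..<n}. M j i) \<in> tuples A n"
  using assms by (auto simp: matrices_def tuples_def PiE_iff)

lemma apply_matrix_in_tuples:
  assumes "f \<in> tuples A n \<rightarrow>\<^sub>E B" and "M \<in> matrices A m n"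
  shows "apply_matrix m n f M \<in> tuples B m"
proof -
  have "f (\<lambda>j\<in>{..<n}. M j i) \<in> B" if "i < m" for i
    using assms(1) matrix_row_in_tuples[OF assms(2) that] by (rule PiE_mem)
  then show ?thesis
    by (auto simp: apply_matrix_def tuples_def)
qed

text \<open>Row by row, renaming the arguments of \<open>f\<close> amounts to picking columns of
  \<open>M\<close>. Both directions of the theorem rest on this identity.\<close>

lemma apply_matrix_reindex:
  assumes "M \<in> matrices A m n" and "\<sigma> ` {..<k} \<subseteq> {..<n}"
  shows "apply_matrix m n (reindex A k n \<sigma> f) M = apply_matrix m k f (\<lambda>j\<in>{..<k}. M (\<sigma> j))"
proof -
  have "reindex A k n \<sigma> f (\<lambda>j\<in>{..<n}. M j i) = f (\<lambda>j\<in>{..<k}. (\<lambda>j\<in>{..<k}. M (\<sigma> j)) j i)"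
    if "i < m" for i
  proof -
    have "(\<lambda>j\<in>{..<k}. (\<lambda>j\<in>{..<n}. M j i) (\<sigma> j)) = (\<lambda>j\<in>{..<k}. (\<lambda>j\<in>{..<k}. M (\<sigma> j)) j i)"
      using assms(2) by (auto simp: restrict_def fun_eq_iff)
    then show ?thesis
      using matrix_row_in_tuples[OF assms(1) that] by (simp add: reindex_def)
  qed
  then show ?thesis
    by (auto simp: apply_matrix_def restrict_def fun_eq_iff)
qed

text \<open>\<open>\<sigma>\<close> injects the places of a column \<open>a\<close> in the selected
  matrix into its places in \<open>M\<close>, so no multiplicity grows.\<close>

lemma matrix_prec_select:
  assumes "matrix_prec A m n M \<phi>" and "inj_on \<sigma> {..<k}" and "\<sigma> ` {..<k} \<subseteq> {..<n}"
  shows "matrix_prec A m k (\<lambda>j\<in>{..<k}. M (\<sigma> j)) \<phi>"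
  unfolding matrix_prec_def
proof
  fix a assume a: "a \<in> tuples A m"
  have "card {j \<in> {..<k}. (\<lambda>j\<in>{..<k}. M (\<sigma> j)) j = a} \<le> card {j \<in> {..<n}. M j = a}"
    by (rule card_inj_on_le[where f = \<sigma>])
      (use assms(2,3) in \<open>auto intro: inj_on_subset\<close>)
  then show "enat (card {j \<in> {..<k}. (\<lambda>j\<in>{..<k}. M (\<sigma> j)) j = a}) \<le> \<phi> a"
    using assms(1) a unfolding matrix_prec_def by (meson enat_ord_simps(1) order_trans)
qed

lemma satisfies_reindex:
  assumes "satisfies A (k, f) c" and "inj_on \<sigma> {..<k}" and "\<sigma> ` {..<k} \<subseteq> {..<n}"
  shows "satisfies A (n, reindex A k n \<sigma> f) c"
proof (cases c)
  case (fields m \<phi> S)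
  have "apply_matrix m n (reindex A k n \<sigma> f) M \<in> S"
    if M: "M \<in> matrices A m n" and prec: "matrix_prec A m n M \<phi>" for M
  proof -
    have "(\<lambda>j\<in>{..<k}. M (\<sigma> j)) \<in> matrices A m k"
      using M assms(3) unfolding matrices_def by (rule select_in_tuples)
    then show ?thesis
      using assms(1) matrix_prec_select[OF prec assms(2,3)] apply_matrix_reindex[OF M assms(3), of f]
      by (simp add: fields)
  qed
  then show ?thesis
    by (simp add: fields)
qed

section \<open>From a characterization to the closure conditions\<close>

lemma characterized_reindex:
  assumes "characterized_by A B C T" and "(k, f) \<in> C"
    and "inj_on \<sigma> {..<k}" and "\<sigma> ` {..<k} \<subseteq> {..<n}" and "n \<ge> 1"
  shows "(n, reindex A k n \<sigma> f) \<in> C"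
proof -
  have C: "C = {f \<in> multivar_functions A B. \<forall>c\<in>T. satisfies A f c}"
    using assms(1) by (simp add: characterized_by_def)
  then have "f \<in> tuples A k \<rightarrow>\<^sub>E B" and sat: "\<forall>c\<in>T. satisfies A (k, f) c"
    using assms(2) by (auto simp: multivar_functions_def)
  then have "(n, reindex A k n \<sigma> f) \<in> multivar_functions A B"
    using reindex_funcset[OF _ assms(4)] assms(5) by (simp add: multivar_functions_def)
  moreover have "\<forall>c\<in>T. satisfies A (n, reindex A k n \<sigma> f) c"
    using sat satisfies_reindex[OF _ assms(3,4)] by blast
  ultimately show ?thesis
    unfolding C by blast
qed

lemma characterized_imp_closed_under_permutation:
  assumes "characterized_by A B C T"
  shows "closed_under_permutation A C"
proof -
  have "zeta A (n, f) \<in> C \<and> tau A (n, f) \<in> C" if f: "(n, f) \<in> C" for n f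
  proof (cases "n > 1")
    case True
    have "inj_on (rotation n) {..<n}" "rotation n ` {..<n} \<subseteq> {..<n}"
      using True by (auto simp: rotation_def inj_on_def)
    moreover have "inj_on (transpose 0 1) {..<n}" "transpose 0 1 ` {..<n} \<subseteq> {..<n}"
      using True by (auto simp: transpose_def inj_on_def)
    ultimately show ?thesis
      using characterized_reindex[OF assms f] True
      unfolding zeta_eq_reindex[OF True] tau_eq_reindex[OF True] by simp
  next
    case False
    then show ?thesis
      using f by simp
  qed
  then show ?thesis
    by (auto simp: closed_under_permutation_def)
qed

lemma characterized_imp_closed_under_dummies:
  assumes "characterized_by A B C T"
  shows "closed_under_dummies A C"
proof -
  have "nabla A (n, f) \<in> C" if "(n, f) \<in> C" for n f
    unfolding nabla_eq_reindex by (rule characterized_reindex[OF assms that]) auto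
  then show ?thesis
    by (auto simp: closed_under_dummies_def)
qed

text \<open>For a given matrix, a constraint tests \<open>g\<close> only at the finitely many rows,
  so a member of \<open>C\<close> that agrees with \<open>g\<close> on them decides the
  test.\<close>

lemma characterized_imp_locally_closed:
  assumes "characterized_by A B C T"
  shows "locally_closed A B C"
  unfolding locally_closed_def
proof (intro allI ballI impI)
  fix n :: nat and g
  assume n: "1 \<le> n" and g: "g \<in> tuples A n \<rightarrow>\<^sub>E B"
    and local: "\<forall>F. finite F \<and> F \<subseteq> tuples A n \<longrightarrow> (\<exists>f. (n, f) \<in> C \<and> restrict g F = restrict f F)"
  have "satisfies A (n, g) c" if c: "c \<in> T" for c
  proof (cases c)
    case (fields m \<phi> S)
    have "apply_matrix m n g M \<in> S"
      if M: "M \<in> matrices A m n" and prec: "matrix_prec A m n M \<phi>" for M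
    proof -
      let ?F = "(\<lambda>i. \<lambda>j\<in>{..<n}. M j i) ` {..<m}"
      have "finite ?F \<and> ?F \<subseteq> tuples A n"
        using matrix_row_in_tuples[OF M] by auto
      then obtain f where f: "(n, f) \<in> C" and eq: "restrict g ?F = restrict f ?F"
        using local by blast
      have "g x = f x" if "x \<in> ?F" for x
        using fun_cong[OF eq, of x] that by simp
      then have "apply_matrix m n g M = apply_matrix m n f M"
        by (auto simp: apply_matrix_def fun_eq_iff)
      moreover have "satisfies A (n, f) c"
        using assms f c by (auto simp: characterized_by_def)
      ultimately show ?thesis
        using M prec by (simp add: fields)
    qed
    then show ?thesis
      by (simp add: fields)
  qed
  then show "(n, g) \<in> C"
    using assms n g by (auto simp: characterized_by_def multivar_functions_def)
qed

section \<open>Separating a function from the class\<close>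

lemma column_selection:
  fixes M N :: "nat \<Rightarrow> 'c"
  assumes "\<And>j. j < k \<Longrightarrow> card {i \<in> {..<k}. N i = N j} \<le> card {i \<in> {..<n}. M i = N j}"
  shows "\<exists>\<sigma>. inj_on \<sigma> {..<k} \<and> \<sigma> ` {..<k} \<subseteq> {..<n} \<and> (\<forall>j<k. N j = M (\<sigma> j))"
proof -
  \<comment> \<open>For each value \<open>a\<close> occurring in \<open>N\<close> separately, its
    places in \<open>N\<close> are injected into its places in \<open>M\<close>.\<close>
  have "\<forall>a \<in> N ` {..<k}. \<exists>e.
      e ` {i \<in> {..<k}. N i = a} \<subseteq> {i \<in> {..<n}. M i = a} \<and> inj_on e {i \<in> {..<k}. N i = a}"
  proof
    fix a assume "a \<in> N ` {..<k}"
    then obtain j where "j < k" and "a = N j"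
      by blast
    then have "card {i \<in> {..<k}. N i = a} \<le> card {i \<in> {..<n}. M i = a}"
      using assms by blast
    then show "\<exists>e. e ` {i \<in> {..<k}. N i = a} \<subseteq> {i \<in> {..<n}. M i = a} \<and>
        inj_on e {i \<in> {..<k}. N i = a}"
      by (intro card_le_inj) simp_all
  qed
  from bchoice[OF this] obtain e where
    e_sub: "\<And>j. j < k \<Longrightarrow> e (N j) ` {i \<in> {..<k}. N i = N j} \<subseteq> {i \<in> {..<n}. M i = N j}" and
    e_inj: "\<And>j. j < k \<Longrightarrow> inj_on (e (N j)) {i \<in> {..<k}. N i = N j}"
    by blast
  \<comment> \<open>The fibres of \<open>N\<close> partition \<open>{..<k}\<close>, so the chosen
    injections glue to one map.\<close>
  define \<sigma> where "\<sigma> j = e (N j) j" for j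
  have \<sigma>: "\<sigma> j < n" "N j = M (\<sigma> j)" if "j < k" for j
  proof -
    have "\<sigma> j \<in> {i \<in> {..<n}. M i = N j}"
      using e_sub[OF that] that unfolding \<sigma>_def by blast
    then show "\<sigma> j < n" "N j = M (\<sigma> j)"
      by simp_all
  qed
  have "inj_on \<sigma> {..<k}"
  proof (rule inj_onI)
    fix i j assume ij: "i \<in> {..<k}" "j \<in> {..<k}" "\<sigma> i = \<sigma> j"
    then have k: "i < k" "j < k"
      by simp_all
    \<comment> \<open>A common value of \<open>\<sigma>\<close> means a common column, so
      \<open>i\<close> and \<open>j\<close> lie in one fibre, where \<open>e (N j)\<close> is
      injective.\<close>
    then have "N i = N j"
      using \<sigma>(2)[OF k(1)] \<sigma>(2)[OF k(2)] ij(3) by simp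
    then show "i = j"
      using inj_onD[OF e_inj[OF k(2)], of i j] ij(3) k by (simp add: \<sigma>_def)
  qed
  then show ?thesis
    using \<sigma> by blast
qed

lemma separating_constraint:
  assumes "A \<noteq> {}" and C: "C \<subseteq> multivar_functions A B"
    and "locally_closed A B C" and "closed_under_permutation A C" and "closed_under_dummies A C"
    and g: "(n, g) \<in> multivar_functions A B" and "(n, g) \<notin> C"
  obtains c where "c \<in> generalized_constraints A B" and "\<forall>f\<in>C. satisfies A f c"
    and "\<not> satisfies A (n, g) c"
proof -
  have n: "n \<ge> 1" and gB: "g \<in> tuples A n \<rightarrow>\<^sub>E B"
    using g by (simp_all add: multivar_functions_def)
  have "(\<forall>F. finite F \<and> F \<subseteq> tuples A n \<longrightarrow> (\<exists>f. (n, f) \<in> C \<and> restrict g F = restrict f F))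
      \<longrightarrow> (n, g) \<in> C"
    using assms(3)[unfolded locally_closed_def, THEN spec, THEN mp, OF n] gB by (rule bspec)
  then have "\<exists>F. finite F \<and> F \<subseteq> tuples A n \<and>
      (\<forall>f. (n, f) \<in> C \<longrightarrow> restrict g F \<noteq> restrict f F)"
    using assms(7) by meson
  then obtain F0 where F0: "finite F0" "F0 \<subseteq> tuples A n"
    and sep0: "\<And>f. (n, f) \<in> C \<Longrightarrow> restrict g F0 \<noteq> restrict f F0"
    by blast
  obtain a where "a \<in> A"
    using assms(1) by blast
  \<comment> \<open>A constraint has arity at least 1, but \<open>F0\<close> may be empty.\<close>
  define F where "F = insert (\<lambda>j\<in>{..<n}. a) F0"
  have F: "finite F" "F \<subseteq> tuples A n" "F \<noteq> {}"
    using F0 \<open>a \<in> A\<close> by (auto simp: F_def tuples_def)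
  have sep: "\<exists>x\<in>F. g x \<noteq> f x" if "(n, f) \<in> C" for f
  proof -
    have "\<exists>x\<in>F0. g x \<noteq> f x"
      using sep0[OF that] restrict_ext[of F0 g f] by blast
    then show ?thesis
      by (simp add: F_def)
  qed
  define m where "m = card F"
  have m: "m \<ge> 1"
    using F by (simp add: m_def Suc_le_eq card_gt_0_iff)
  obtain h where "bij_betw h {..<m} F"
    using ex_bij_betw_nat_finite[OF F(1)] by (auto simp: m_def atLeast0LessThan)
  then have h: "h ` {..<m} = F"
    by (rule bij_betw_imp_surj_on)
  \<comment> \<open>Row \<open>i\<close> of \<open>M\<close> is the point \<open>h i\<close>, so
    applying a function to \<open>M\<close> tabulates its values on \<open>F\<close>.\<close>
  define M where "M = (\<lambda>j\<in>{..<n}. \<lambda>i\<in>{..<m}. h i j)"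
  have h_tuple: "h i \<in> tuples A n" if "i < m" for i
    using h F(2) that by blast
  have M: "M \<in> matrices A m n"
    using h_tuple by (auto simp: M_def matrices_def tuples_def PiE_iff)
  have row_value: "apply_matrix m n u M i = u (h i)" if "i < m" for i and u :: "(nat \<Rightarrow> 'a) \<Rightarrow> 'b"
  proof -
    have "(\<lambda>j\<in>{..<n}. M j i) = restrict (h i) {..<n}"
      using that by (intro restrict_ext) (simp add: M_def)
    also have "\<dots> = h i"
      using h_tuple[OF that] unfolding tuples_def by (rule PiE_restrict)
    finally show ?thesis
      using that by (simp add: apply_matrix_def)
  qed
  \<comment> \<open>This is the least repetition function that admits \<open>M\<close>; the matrices
    it admits are the selections of distinct columns of \<open>M\<close>, in any order.\<close>
  define \<phi> where "\<phi> = (\<lambda>a\<in>tuples A m. enat (card {j \<in> {..<n}. M j = a}))"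
  \<comment> \<open>This is the least set for which every member of \<open>C\<close> satisfies the
    constraint. Members of all arities \<open>k\<close> contribute, so a substitution is needed
    below to return to arity \<open>n\<close>.\<close>
  define S where "S = {apply_matrix m k f N | k f N.
    (k, f) \<in> C \<and> N \<in> matrices A m k \<and> matrix_prec A m k N \<phi>}"
  have "S \<subseteq> tuples B m"
  proof
    fix y assume "y \<in> S"
    then obtain k f N where "(k, f) \<in> C" and N: "N \<in> matrices A m k"
      and y: "y = apply_matrix m k f N"
      by (auto simp: S_def)
    then have "f \<in> tuples A k \<rightarrow>\<^sub>E B"
      using C by (auto simp: multivar_functions_def)
    then show "y \<in> tuples B m"
      unfolding y using N by (rule apply_matrix_in_tuples)
  qed
  then have "(m, \<phi>, S) \<in> generalized_constraints A B"
    using m by (auto simp: generalized_constraints_def repetition_functions_def \<phi>_def)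
  moreover have "satisfies A f (m, \<phi>, S)" if "f \<in> C" for f
    using that by (cases f) (auto simp: S_def)
  moreover have "apply_matrix m n g M \<notin> S"
  proof
    assume "apply_matrix m n g M \<in> S"
    then obtain k f N where f: "(k, f) \<in> C" and N: "N \<in> matrices A m k"
      and prec: "matrix_prec A m k N \<phi>" and eq: "apply_matrix m n g M = apply_matrix m k f N"
      by (auto simp: S_def)
    have "card {i \<in> {..<k}. N i = N j} \<le> card {i \<in> {..<n}. M i = N j}" if "j < k" for j
    proof -
      have "N j \<in> tuples A m"
        using N that by (auto simp: matrices_def tuples_def[of _ k])
      then show ?thesis
        using prec by (auto simp: matrix_prec_def \<phi>_def)
    qed
    from column_selection[OF this] obtain \<sigma> where \<sigma>: "inj_on \<sigma> {..<k}" "\<sigma> ` {..<k} \<subseteq> {..<n}"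
      and NM: "\<And>j. j < k \<Longrightarrow> N j = M (\<sigma> j)"
      by blast
    have "(\<lambda>j\<in>{..<k}. M (\<sigma> j)) = restrict N {..<k}"
      using NM by (intro restrict_ext) simp
    also have "\<dots> = N"
      using N unfolding matrices_def tuples_def[of _ k] by (rule PiE_restrict)
    finally have "(\<lambda>j\<in>{..<k}. M (\<sigma> j)) = N" .
    \<comment> \<open>The substituted function has the arity of \<open>g\<close> and is applied to
      the same \<open>M\<close>, so the two can be compared at the points of
      \<open>F\<close>.\<close>
    then have "apply_matrix m n g M = apply_matrix m n (reindex A k n \<sigma> f) M"
      using apply_matrix_reindex[OF M \<sigma>(2), of f] eq by simp
    then have "g (h i) = reindex A k n \<sigma> f (h i)" if "i < m" for i
      using row_value[OF that, of g] row_value[OF that, of "reindex A k n \<sigma> f"] by simp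
    moreover have "(n, reindex A k n \<sigma> f) \<in> C"
      by (rule closed_under_injective_reindex[OF C assms(4,5) f \<sigma>])
    ultimately show False
      using sep h by blast
  qed
  moreover have "matrix_prec A m n M \<phi>"
    by (simp add: matrix_prec_def \<phi>_def)
  ultimately show thesis
    using M by (intro that[of "(m, \<phi>, S)"]) auto
qed

theorem theorem3p2:
  fixes A :: "'a set" and B :: "'b set" and \<F> :: "('a, 'b) mfun set"
  assumes "A \<noteq> {}" and "B \<noteq> {}"
    and "\<F> \<subseteq> multivar_functions A B"
  shows "(locally_closed A B \<F> \<and> closed_under_permutation A \<F> \<and> closed_under_dummies A \<F>)
     \<longleftrightarrow> (\<exists>T \<subseteq> generalized_constraints A B. characterized_by A B \<F> T)"
proof (intro iffI; elim conjE exE)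
  assume closed: "locally_closed A B \<F>" "closed_under_permutation A \<F>" "closed_under_dummies A \<F>"
  \<comment> \<open>The largest candidate: if any set of constraints characterizes the class, it is
    contained in this one. Functions outside the class are excluded by
    \<open>separating_constraint\<close>.\<close>
  define T where "T = {c \<in> generalized_constraints A B. \<forall>f\<in>\<F>. satisfies A f c}"
  have "(n, g) \<in> \<F>"
    if g: "(n, g) \<in> multivar_functions A B" and sat: "\<forall>c\<in>T. satisfies A (n, g) c" for n g
  proof (rule ccontr)
    assume "(n, g) \<notin> \<F>"
    from separating_constraint[OF assms(1,3) closed g this]
    obtain c where "c \<in> T" and "\<not> satisfies A (n, g) c"
      unfolding T_def by blast
    then show False
      using sat by blast
  qed
  then have "characterized_by A B \<F> T"
    using assms(3) by (auto simp: characterized_by_def T_def)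
  then show "\<exists>T \<subseteq> generalized_constraints A B. characterized_by A B \<F> T"
    by (intro exI[of _ T]) (auto simp: T_def)
next
  fix T assume "characterized_by A B \<F> T"
  then show "locally_closed A B \<F> \<and> closed_under_permutation A \<F> \<and> closed_under_dummies A \<F>"
    using characterized_imp_locally_closed characterized_imp_closed_under_permutation
      characterized_imp_closed_under_dummies by blast
qed

end
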